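(* Let $\Phi=\{\phi_1,\ldots,\phi_r\}$ be a family of nonzero graph signals, and let $\mathbf{T}=a_1\mathbf{S}_1+\cdots+a_d\mathbf{S}_d$, where the real coefficients $a_1,\ldots,a_d$ are chosen so that the numbers $\mu(m):=\sum_{l=1}^d a_l\gamma_l(m)$, $1\le m\le M$, are distinct. Then the family $\{\mathbf{T}^k\phi_i : 0\le k\le M-1,\ 1\le i\le r\}$ forms a Riesz basis for $\mathcal{S}(\Phi)$ if and only if $$\dim_{\mathcal{S}(\Phi)}(\boldsymbol{\gamma}(m))=r\quad\text{for all}\ 1\le m\le M.$$
   Context: Let $\mathcal{G}=(V,E,\mathbf{W})$ be a finite, simple, undirected graph with $N\ge 2$ vertices. A graph signal is a vector in $\mathbb{R}^V$, with Euclidean norm $\|\cdot\|_2$. A graph shift is a matrix $\mathbf{S}=[s(i,j)]_{i,j\in V}$ with $s(i,j)=0$ unless $i=j$ or $(i,j)\in E$. Standing assumption: $\mathbf{S}_1,\ldots,\mathbf{S}_d$ are graph shifts that are real-valued, symmetric and pairwise commuting. Choose an orthogonal matrix $\mathbf{U}=[\mathbf{u}_1,\ldots,\mathbf{u}_N]$ with $\mathbf{S}_l=\sum_{n=1}^N\lambda_l(n)\mathbf{u}_n\mathbf{u}_n^T$ for $1\le l\le d$, and set $\boldsymbol{\lambda}(n)=[\lambda_1(n),\ldots,\lambda_d(n)]^T\in\mathbb{R}^d$. Let $\boldsymbol{\gamma}(m)=[\gamma_1(m),\ldots,\gamma_d(m)]^T$, $1\le m\le M$, be the distinct elements of $\{\boldsymbol{\lambda}(n):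 1\le n\le N\}$, and let $W_m=\bigcap_{l=1}^d\ker(\mathbf{S}_l-\gamma_l(m)\mathbf{I})$. For a family $\Phi$ of graph signals, $\mathcal{S}(\Phi)=\mathrm{span}\{\mathbf{S}_1^{\alpha_1}\cdots\mathbf{S}_d^{\alpha_d}\phi : \alpha_1,\ldots,\alpha_d\in\mathbb{Z}_+,\ \phi\in\Phi\}$ ($\mathbb{Z}_+$ the nonnegative integers), and $\dim_{\mathcal{S}(\Phi)}(\boldsymbol{\gamma}(m))=\dim(\mathcal{S}(\Phi)\cap W_m)$. An indexed finite family $(f_j)_j$ is a Riesz basis of a subspace of $\mathbb{R}^V$ if it spans the subspace and there are constants $0<A\le B$ with $A(\sum_j|c_j|^2)^{1/2}\le\|\sum_jc_jf_j\|_2\le B(\sum_j|c_j|^2)^{1/2}$ for all real coefficients $(c_j)_j$. *)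

theory Defs
  imports "HOL-Analysis.Analysis"
begin

(* The vertex set V is the universe of the finite type 'v, and E is the set of ordered
   pairs of adjacent vertices.  Families written with indices 1..d, 1..M, 1..r are
   functions on nat, of which only the values on these ranges matter. *)

definition simple_undirected_graph :: "'v::finite rel \<Rightarrow> bool" where
  "simple_undirected_graph E \<longleftrightarrow> sym E \<and> irrefl E"

definition graph_shift :: "'v::finite rel \<Rightarrow> real^'v^'v \<Rightarrow> bool" where
  "graph_shift E S \<longleftrightarrow> (\<forall>i j. i \<noteq> j \<and> (i, j) \<notin> E \<longrightarrow> S $ i $ j = 0)"

(* The rank-one matrix u u^T. *)
definition outer :: "real^'v \<Rightarrow> real^'v^'v" where
  "outer u = (\<chi> i j. u $ i * u $ j)"

(* The columns u_n of U and the eigenvalues lam l n are indexed by n in 'v,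
   as 'v has exactly N elements. *)
definition joint_eigendecomposition ::
    "nat \<Rightarrow> (nat \<Rightarrow> real^'v^'v) \<Rightarrow> real^'v^'v \<Rightarrow> (nat \<Rightarrow> 'v::finite \<Rightarrow> real) \<Rightarrow> bool" where
  "joint_eigendecomposition d S U lam \<longleftrightarrow>
     orthogonal_matrix U \<and>
     (\<forall>l\<in>{1..d}. S l = (\<Sum>n\<in>UNIV. lam l n *\<^sub>R outer (column n U)))"

(* A point of R^d is represented by a function on nat restricted to {1..d}
   (undefined elsewhere), so that equality of points is equality of functions. *)
definition joint_spectrum :: "nat \<Rightarrow> (nat \<Rightarrow> 'v::finite \<Rightarrow> real) \<Rightarrow> (nat \<Rightarrow> real) set" where
  "joint_spectrum d lam = range (\<lambda>n. restrict (\<lambda>l. lam l n) {1..d})"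

definition joint_eigenspace ::
    "nat \<Rightarrow> (nat \<Rightarrow> real^'v^'v) \<Rightarrow> (nat \<Rightarrow> real) \<Rightarrow> (real^'v::finite) set" where
  "joint_eigenspace d S g = (\<Inter>l\<in>{1..d}. {x. (S l - g l *\<^sub>R mat 1) *v x = 0})"

primrec matpow :: "real^'v^'v \<Rightarrow> nat \<Rightarrow> real^'v::finite^'v" where
  "matpow A 0 = mat 1"
| "matpow A (Suc k) = A ** matpow A k"

(* S_1^(alpha 1) ** ... ** S_d^(alpha d) *)
definition shift_monomial ::
    "nat \<Rightarrow> (nat \<Rightarrow> real^'v^'v) \<Rightarrow> (nat \<Rightarrow> nat) \<Rightarrow> real^'v::finite^'v" where
  "shift_monomial d S \<alpha> =
     foldr (**) (map (\<lambda>l. matpow (S l) (\<alpha> l)) [1..<Suc d]) (mat 1)"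

definition shift_invariant_space ::
    "nat \<Rightarrow> (nat \<Rightarrow> real^'v^'v) \<Rightarrow> (real^'v::finite) set \<Rightarrow> (real^'v) set" where
  "shift_invariant_space d S \<Phi> = span {shift_monomial d S \<alpha> *v \<phi> | \<alpha> \<phi>. \<phi> \<in> \<Phi>}"

definition spectral_dim ::
    "nat \<Rightarrow> (nat \<Rightarrow> real^'v^'v) \<Rightarrow> (real^'v::finite) set \<Rightarrow> (nat \<Rightarrow> real) \<Rightarrow> nat" where
  "spectral_dim d S H g = dim (H \<inter> joint_eigenspace d S g)"

(* Riesz basis for an indexed family: repeated vectors at different indices count as
   different members.  L2_set c J is sqrt (\<Sum>j\<in>J. (c j)^2). *)
definition riesz_basis :: "'i set \<Rightarrow> ('i \<Rightarrow> 'a::euclidean_space) \<Rightarrow> 'a set \<Rightarrow> bool" where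
  "riesz_basis J f H \<longleftrightarrow>
     finite J \<and> span (f ` J) = H \<and>
     (\<exists>A B. 0 < A \<and> A \<le> B \<and>
        (\<forall>c :: 'i \<Rightarrow> real.
           A * L2_set c J \<le> norm (\<Sum>j\<in>J. c j *\<^sub>R f j) \<and>
           norm (\<Sum>j\<in>J. c j *\<^sub>R f j) \<le> B * L2_set c J))"

end

theory Submission
  imports Defs
begin

text \<open>Split each \<open>\<phi> i\<close> into its components in the joint eigenspaces. Lagrange interpolation at the
  distinct eigenvalues of \<open>T\<close> recovers these components from the vectors \<open>T\<^sup>k (\<phi> i)\<close> with
  \<open>k < M\<close>, so the family always spans the shift-invariant space \<open>H\<close>, and being a Riesz basis
  amounts to \<open>dim H = M * r\<close>. Since \<open>H\<close> is the orthogonal sum of the spans of the components,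
  each of dimension at most \<open>r\<close>, this happens iff all these dimensions equal \<open>r\<close>.\<close>

section \<open>Riesz bases in finite dimension\<close>

lemma card_eq_dim_span_iff_independent_family:
  fixes f :: "'i \<Rightarrow> 'a::euclidean_space"
  assumes "finite J"
  shows "dim (span (f ` J)) = card J \<longleftrightarrow> inj_on f J \<and> independent (f ` J)"
proof
  assume eq: "dim (span (f ` J)) = card J"
  \<comment> \<open>The chain \<open>dim (f\<close> J)\<open>\<le>\<close>card (f \<open>J)\<close>
    \<le> \<open>card J\<close> collapses to equalities: the first yields independence, the second
    injectivity.\<close>
  have le: "dim (f ` J) \<le> card (f ` J)" "card (f ` J) \<le> card J"
    using assms by (auto simp: dim_le_card' card_image_le)
  with eq have c: "card (f ` J) = card J" by simp
  have "independent (f ` J)"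
    by (rule card_le_dim_spanning[of _ "span (f ` J)"]) (use assms eq c in \<open>auto simp: span_base\<close>)
  then show "inj_on f J \<and> independent (f ` J)"
    using assms c by (simp add: eq_card_imp_inj_on)
next
  assume "inj_on f J \<and> independent (f ` J)"
  then show "dim (span (f ` J)) = card J"
    by (simp add: dim_eq_card_independent card_image)
qed

text \<open>The lower bound forces every vanishing combination to have zero coefficients. Since
  \<open>independent\<close> speaks of sets and is blind to repeated vectors, injectivity has to be
  extracted separately.\<close>

lemma riesz_basis_imp_independent:
  fixes f :: "'i \<Rightarrow> 'a::euclidean_space"
  assumes "riesz_basis J f H"
  shows "inj_on f J \<and> independent (f ` J)"
proof -
  have fin: "finite J" using assms by (simp add: riesz_basis_def)
  obtain A where A: "A > 0" "\<And>c. A * L2_set c J \<le> norm (\<Sum>j\<in>J. c j *\<^sub>R f j)"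
    using assms unfolding riesz_basis_def by blast
  have zero: "c j = 0" if "(\<Sum>j\<in>J. c j *\<^sub>R f j) = 0" "j \<in> J" for c j
  proof -
    have "A * L2_set c J \<le> 0" using A(2)[of c] that by simp
    then have "L2_set c J = 0"
      using A(1) L2_set_nonneg[of c J] by (simp add: mult_le_0_iff)
    then show ?thesis using fin that by (simp add: L2_set_eq_0_iff)
  qed
  have inj: "inj_on f J"
  proof (rule inj_onI, rule ccontr)
    fix i j assume ij: "i \<in> J" "j \<in> J" "f i = f j" "i \<noteq> j"
    \<comment> \<open>The coefficients of \<open>f i - f j\<close>, a nontrivial combination that
      would vanish.\<close>
    let ?c = "\<lambda>k. (if k = i then 1 else 0) - (if k = j then 1 else 0) :: real"
    have "(\<Sum>k\<in>J. ?c k *\<^sub>R f k)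
        = (\<Sum>k\<in>J. if k = i then f k else 0) - (\<Sum>k\<in>J. if k = j then f k else 0)"
      by (simp add: scaleR_left_diff_distrib sum_subtractf if_distrib[of "\<lambda>t. t *\<^sub>R _"] cong: if_cong)
    also have "\<dots> = 0" using fin ij by simp
    finally show False using zero[of ?c i] ij by simp
  qed
  have "independent (f ` J)"
    unfolding independent_explicit
  proof (intro conjI allI impI ballI)
    fix u v assume u: "(\<Sum>v\<in>f ` J. u v *\<^sub>R v) = 0" and v: "v \<in> f ` J"
    then have "(\<Sum>j\<in>J. u (f j) *\<^sub>R f j) = 0" by (simp add: sum.reindex[OF inj])
    then show "u v = 0" using zero[of "u \<circ> f"] v by auto
  qed (use fin in simp)
  with inj show ?thesis by simp
qed

text \<open>The lower Riesz bound comes from the boundedness of the coordinate functionals.\<close>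

lemma independent_imp_riesz_basis:
  fixes f :: "'i \<Rightarrow> 'a::euclidean_space"
  assumes fin: "finite J" and inj: "inj_on f J" and ind: "independent (f ` J)"
  shows "riesz_basis J f (span (f ` J))"
proof -
  \<comment> \<open>Dual functionals of the family, extended to the whole space so that each has an
    operator norm.\<close>
  have "\<exists>g :: 'a \<Rightarrow> real. linear g \<and> (\<forall>x\<in>f ` J. g x = (if x = f j then 1 else 0))" for j
    by (rule linear_independent_extend[OF ind])
  then obtain g :: "'i \<Rightarrow> 'a \<Rightarrow> real"
    where g: "\<And>j. linear (g j)" "\<And>j x. x \<in> f ` J \<Longrightarrow> g j x = (if x = f j then 1 else 0)"
    by metis
  have coord: "g i (\<Sum>j\<in>J. c j *\<^sub>R f j) = c i" if "i \<in> J" for c i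
  proof -
    have "g i (\<Sum>j\<in>J. c j *\<^sub>R f j) = (\<Sum>j\<in>J. c j * g i (f j))"
      by (simp add: linear_sum[OF g(1)] linear_cmul[OF g(1)])
    also have "\<dots> = (\<Sum>j\<in>J. if j = i then c j else 0)"
      using that inj by (intro sum.cong) (auto simp: g(2) inj_on_eq_iff)
    finally show ?thesis using fin that by simp
  qed
  \<comment> \<open>Summing the bounds on the single coefficients gives the lower constant
    \<open>1 / K\<close>. The added 1 keeps \<open>K\<close> positive even for empty
    \<open>J\<close>.\<close>
  define K where "K = 1 + (\<Sum>j\<in>J. onorm (g j))"
  have bl: "bounded_linear (g j)" for j by (simp add: g(1) linear_linear)
  have K: "K \<ge> 1" unfolding K_def by (simp add: sum_nonneg onorm_pos_le bl)
  \<comment> \<open>The upper constant comes from Cauchy-Schwarz; adding 1 gives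
    \<open>1 / K\<close> \<le> 1 \<le> \<open>B\<close>.\<close>
  define B where "B = L2_set (\<lambda>j. norm (f j)) J + 1"
  have B: "B \<ge> 1" by (simp add: B_def)
  have lower: "1 / K * L2_set c J \<le> norm (\<Sum>j\<in>J. c j *\<^sub>R f j)" for c
  proof -
    let ?x = "\<Sum>j\<in>J. c j *\<^sub>R f j"
    have "L2_set c J \<le> (\<Sum>j\<in>J. \<bar>c j\<bar>)" by (rule L2_set_le_sum_abs)
    also have "\<dots> \<le> (\<Sum>j\<in>J. onorm (g j) * norm ?x)"
    proof (rule sum_mono)
      fix j assume "j \<in> J"
      then show "\<bar>c j\<bar> \<le> onorm (g j) * norm ?x"
        using onorm[OF bl, of j ?x] by (simp add: coord)
    qed
    also have "\<dots> = (\<Sum>j\<in>J. onorm (g j)) * norm ?x" by (simp add: sum_distrib_right)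
    also have "\<dots> \<le> K * norm ?x" by (simp add: K_def distrib_right)
    finally show ?thesis using K by (simp add: field_simps)
  qed
  have upper: "norm (\<Sum>j\<in>J. c j *\<^sub>R f j) \<le> B * L2_set c J" for c
  proof -
    have "norm (\<Sum>j\<in>J. c j *\<^sub>R f j) \<le> (\<Sum>j\<in>J. \<bar>c j\<bar> * \<bar>norm (f j)\<bar>)"
      by (rule order_trans[OF norm_sum]) simp
    also have "\<dots> \<le> L2_set c J * L2_set (\<lambda>j. norm (f j)) J" by (rule L2_set_mult_ineq)
    also have "\<dots> \<le> B * L2_set c J" by (simp add: B_def algebra_simps)
    finally show ?thesis .
  qed
  have "1 / K \<le> B" using K B by (intro order_trans[of "1 / K" 1 B]) simp_all
  then show ?thesis
    unfolding riesz_basis_def using fin K lower upper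
    by (intro conjI exI[of _ "1 / K"] exI[of _ B]) auto
qed

text \<open>In finite dimension the two bounds amount to linear independence of the indexed family,
  so that the analytic condition becomes a count of dimensions.\<close>

lemma riesz_basis_iff_dim:
  fixes f :: "'i \<Rightarrow> 'a::euclidean_space"
  assumes "finite J"
  shows "riesz_basis J f H \<longleftrightarrow> span (f ` J) = H \<and> dim H = card J"
proof
  assume *: "riesz_basis J f H"
  then have "span (f ` J) = H" by (simp add: riesz_basis_def)
  with riesz_basis_imp_independent[OF *] show "span (f ` J) = H \<and> dim H = card J"
    using card_eq_dim_span_iff_independent_family[OF assms, of f] by blast
next
  assume "span (f ` J) = H \<and> dim H = card J"
  then show "riesz_basis J f H"
    using card_eq_dim_span_iff_independent_family[OF assms, of f]
      independent_imp_riesz_basis[OF assms, of f] by blast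
qed

section \<open>Orthogonal sums of subspaces\<close>

lemma dim_UN_orthogonal:
  fixes A :: "'i \<Rightarrow> 'a::euclidean_space set"
  assumes "finite I"
    and "\<And>i j x y. i \<in> I \<Longrightarrow> j \<in> I \<Longrightarrow> i \<noteq> j \<Longrightarrow> x \<in> A i \<Longrightarrow> y \<in> A j \<Longrightarrow> x \<bullet> y = 0"
  shows "dim (\<Union>i\<in>I. A i) = (\<Sum>i\<in>I. dim (A i))"
  using assms
proof (induction I rule: finite_induct)
  case (insert i F)
  have "dim (A i \<union> (\<Union>j\<in>F. A j)) = dim (A i) + dim (\<Union>j\<in>F. A j)"
    by (rule dim_orthogonal_sum) (use insert in blast)
  moreover have "dim (\<Union>j\<in>F. A j) = (\<Sum>j\<in>F. dim (A j))"
    using insert by blast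
  ultimately show ?case using insert.hyps by simp
qed simp

text \<open>Subtracting from a vector of \<open>W i\<close> its part in \<open>span (A i)\<close>
  leaves a vector that lies in \<open>W i\<close> and in the span of the other blocks. It is
  therefore orthogonal to itself, hence zero.\<close>

lemma span_UN_Int_orthogonal:
  fixes A W :: "'i \<Rightarrow> 'a::euclidean_space set"
  assumes sub: "\<And>i. i \<in> I \<Longrightarrow> subspace (W i)" and AW: "\<And>i. i \<in> I \<Longrightarrow> A i \<subseteq> W i"
    and orth: "\<And>i j x y. i \<in> I \<Longrightarrow> j \<in> I \<Longrightarrow> i \<noteq> j \<Longrightarrow> x \<in> W i \<Longrightarrow> y \<in> W j \<Longrightarrow> x \<bullet> y = 0"
    and i: "i \<in> I"
  shows "span (\<Union>j\<in>I. A j) \<inter> W i = span (A i)"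
proof
  show "span (A i) \<subseteq> span (\<Union>j\<in>I. A j) \<inter> W i"
    using i by (auto intro: span_mono[THEN subsetD] span_minimal[OF AW sub, THEN subsetD])
  show "span (\<Union>j\<in>I. A j) \<inter> W i \<subseteq> span (A i)"
  proof
    fix x assume x: "x \<in> span (\<Union>j\<in>I. A j) \<inter> W i"
    have "(\<Union>j\<in>I. A j) = A i \<union> (\<Union>j\<in>I-{i}. A j)" using i by blast
    with x obtain y z where yz: "x = y + z" "y \<in> span (A i)" "z \<in> span (\<Union>j\<in>I-{i}. A j)"
      by (auto simp: span_Un)
    have "y \<in> W i" using yz(2) i span_minimal[OF AW sub] by blast
    moreover have "z = x - y" using yz(1) by simp
    ultimately have "z \<in> W i" using x sub[OF i] by (simp add: subspace_diff)
    then have "orthogonal z w" if "w \<in> (\<Union>j\<in>I-{i}. A j)" for w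
      using that orth[OF i] AW unfolding orthogonal_def by blast
    then have "orthogonal z z" using yz(3) orthogonal_to_span by blast
    then show "x \<in> span (A i)" using yz by (simp add: orthogonal_def)
  qed
qed

section \<open>Krylov spans and interpolation at the eigenvalues\<close>

lemma matrix_vector_mult_sum_right:
  fixes A :: "real^'n^'m"
  shows "A *v (\<Sum>i\<in>I. f i) = (\<Sum>i\<in>I. A *v f i)"
  by (rule linear_sum) simp

lemma matrix_vector_mult_sum_left:
  fixes A :: "'i \<Rightarrow> real^'n^'m"
  shows "(\<Sum>i\<in>I. A i) *v x = (\<Sum>i\<in>I. A i *v x)"
  by (induction I rule: infinite_finite_induct) (auto simp: matrix_vector_mult_add_rdistrib)

lemma matpow_eigenvector:
  fixes A :: "real^'v::finite^'v"
  assumes "A *v v = c *\<^sub>R v"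
  shows "matpow A k *v v = (c ^ k) *\<^sub>R v"
  by (induction k)
    (simp_all add: assms matrix_vector_mul_assoc[symmetric] matrix_vector_mult_scaleR mult.commute)

text \<open>Apply to \<open>T\<close> the polynomial that vanishes at all eigenvalues except \<open>\<mu> m\<close>.\<close>

lemma eigencomponent_in_krylov_span:
  fixes T :: "real^'v::finite^'v"
  assumes fin: "finite I" and inj: "inj_on \<mu> I" and m: "m \<in> I"
    and eig: "\<And>j. j \<in> I \<Longrightarrow> T *v v j = \<mu> j *\<^sub>R v j"
  shows "v m \<in> span ((\<lambda>k. matpow T k *v (\<Sum>j\<in>I. v j)) ` {..card I - 1})"
proof -
  define q where "q = (\<Prod>j\<in>I-{m}. [:- \<mu> j, 1:])"
  \<comment> \<open>One linear factor for each eigenvalue other than \<open>\<mu> m\<close>, which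
    is why powers up to \<open>card I - 1\<close> suffice.\<close>
  have deg: "degree q = card I - 1"
    unfolding q_def by (subst degree_prod_eq_sum_degree) (use fin m in auto)
  have q0: "poly q (\<mu> j) = 0" if "j \<in> I" "j \<noteq> m" for j
    using that fin by (auto simp: q_def poly_prod)
  have qm: "poly q (\<mu> m) \<noteq> 0"
    using fin m inj by (auto simp: q_def poly_prod inj_on_def)
  \<comment> \<open>The left side is q(T) applied to the sum; on the eigenvector \<open>v j\<close>
    it acts as the scalar \<open>poly q (\<mu> j)\<close>.\<close>
  have "(\<Sum>k\<le>card I - 1. coeff q k *\<^sub>R (matpow T k *v (\<Sum>j\<in>I. v j)))
      = (\<Sum>k\<le>card I - 1. \<Sum>j\<in>I. (coeff q k * \<mu> j ^ k) *\<^sub>R v j)"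
    by (simp add: matrix_vector_mult_sum_right matpow_eigenvector[OF eig] scaleR_sum_right)
  also have "\<dots> = (\<Sum>j\<in>I. poly q (\<mu> j) *\<^sub>R v j)"
    by (subst sum.swap) (simp add: poly_altdef deg scaleR_sum_left)
  also have "\<dots> = (\<Sum>j\<in>I. if j = m then poly q (\<mu> m) *\<^sub>R v m else 0)"
    by (rule sum.cong) (auto simp: q0)
  also have "\<dots> = poly q (\<mu> m) *\<^sub>R v m" using fin m by simp
  finally have "v m = (1 / poly q (\<mu> m)) *\<^sub>R
      (\<Sum>k\<le>card I - 1. coeff q k *\<^sub>R (matpow T k *v (\<Sum>j\<in>I. v j)))"
    using qm by simp
  also have "\<dots> \<in> span ((\<lambda>k. matpow T k *v (\<Sum>j\<in>I. v j)) ` {..card I - 1})"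
    by (intro span_scale span_sum span_base) auto
  finally show ?thesis .
qed

text \<open>Powers of \<open>T\<close> only rescale eigencomponents, which gives one inclusion;
  interpolation gives the other. Components may be zero or coincide.\<close>

lemma span_krylov_eq_span_eigencomponents:
  fixes T :: "real^'v::finite^'v"
  assumes fin: "finite I" and inj: "inj_on \<mu> I"
    and eig: "\<And>i m. i \<in> J \<Longrightarrow> m \<in> I \<Longrightarrow> T *v v i m = \<mu> m *\<^sub>R v i m"
    and dec: "\<And>i. i \<in> J \<Longrightarrow> \<phi> i = (\<Sum>m\<in>I. v i m)"
  shows "span ((\<lambda>(k, i). matpow T k *v \<phi> i) ` ({0..card I - 1} \<times> J))
    = span (\<Union>m\<in>I. (\<lambda>i. v i m) ` J)" (is "span ?K = span ?V")
proof (rule span_eq[THEN iffD2], intro conjI subsetI)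
  fix x assume "x \<in> ?K"
  then obtain k i where i: "i \<in> J" and x: "x = matpow T k *v \<phi> i" by auto
  have "x = (\<Sum>m\<in>I. \<mu> m ^ k *\<^sub>R v i m)"
    using i by (simp add: x dec matrix_vector_mult_sum_right matpow_eigenvector[OF eig])
  also have "\<dots> \<in> span ?V" using i by (intro span_sum span_scale span_base) auto
  finally show "x \<in> span ?V" .
next
  fix x assume "x \<in> ?V"
  then obtain m i where mi: "m \<in> I" "i \<in> J" and x: "x = v i m" by auto
  have "x \<in> span ((\<lambda>k. matpow T k *v \<phi> i) ` {..card I - 1})"
    unfolding x dec[OF mi(2)]
    by (rule eigencomponent_in_krylov_span) (use fin inj mi eig in auto)
  also have "\<dots> \<subseteq> span ?K" by (rule span_mono) (use mi in force)
  finally show "x \<in> span ?K" .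
qed

section \<open>Invariance of the shift-invariant space\<close>

lemma matpow_commute:
  assumes "A ** B = B ** A"
  shows "A ** matpow B k = matpow B k ** A"
  by (induction k) (simp_all add: matrix_mul_assoc assms, simp add: matrix_mul_assoc[symmetric])

text \<open>\<open>S l\<close> commutes past the powers of the other shifts until it meets its own.
  An arbitrary list \<open>ls\<close> makes the induction possible, and distinctness ensures that
  exactly one factor absorbs \<open>S l\<close>.\<close>

lemma foldr_matpow_increment:
  fixes S :: "nat \<Rightarrow> real^'v::finite^'v"
  assumes "distinct ls" "l \<in> set ls" "\<And>l'. l' \<in> set ls \<Longrightarrow> S l ** S l' = S l' ** S l"
  shows "S l ** foldr (**) (map (\<lambda>l. matpow (S l) (\<alpha> l)) ls) (mat 1)
    = foldr (**) (map (\<lambda>k. matpow (S k) ((\<alpha>(l := Suc (\<alpha> l))) k)) ls) (mat 1)"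
  using assms
proof (induction ls)
  case (Cons h t)
  show ?case
  proof (cases "h = l")
    case True
    \<comment> \<open>By distinctness \<open>l\<close> does not recur in the tail, so the raised
      exponent leaves the tail unchanged.\<close>
    have "map (\<lambda>k. matpow (S k) ((\<alpha>(l := Suc (\<alpha> l))) k)) t = map (\<lambda>l. matpow (S l) (\<alpha> l)) t"
      using Cons.prems True by auto
    then have "foldr (**) (map (\<lambda>k. matpow (S k) ((\<alpha>(l := Suc (\<alpha> l))) k)) t) (mat 1)
        = foldr (**) (map (\<lambda>l. matpow (S l) (\<alpha> l)) t) (mat 1)"
      by (rule arg_cong)
    then show ?thesis using True by (simp add: matrix_mul_assoc del: map_eq_conv)
  next
    case False
    let ?R = "foldr (**) (map (\<lambda>l. matpow (S l) (\<alpha> l)) t) (mat 1)"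
    have "S l ** (matpow (S h) (\<alpha> h) ** ?R) = matpow (S h) (\<alpha> h) ** (S l ** ?R)"
      using matpow_commute[of "S l" "S h" "\<alpha> h"] Cons.prems(3)[of h]
      by (simp add: matrix_mul_assoc)
    also have "S l ** ?R
        = foldr (**) (map (\<lambda>k. matpow (S k) ((\<alpha>(l := Suc (\<alpha> l))) k)) t) (mat 1)"
      by (rule Cons.IH) (use Cons.prems False in auto)
    finally show ?thesis using False by simp
  qed
qed simp

text \<open>Multiplication by \<open>S l\<close> raises one exponent, so it sends generators to
  generators.\<close>

lemma shift_invariant_space_invariant:
  fixes S :: "nat \<Rightarrow> real^'v::finite^'v"
  assumes comm: "\<And>l'. l' \<in> {1..d} \<Longrightarrow> S l ** S l' = S l' ** S l" and l: "l \<in> {1..d}"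
    and x: "x \<in> shift_invariant_space d S \<Phi>"
  shows "S l *v x \<in> shift_invariant_space d S \<Phi>"
  using x unfolding shift_invariant_space_def
proof (induction rule: span_induct_alt)
  case (step c x y)
  then obtain \<alpha> p where p: "x = shift_monomial d S \<alpha> *v p" "p \<in> \<Phi>" by blast
  have "S l ** shift_monomial d S \<alpha> = shift_monomial d S (\<alpha>(l := Suc (\<alpha> l)))"
    unfolding shift_monomial_def by (rule foldr_matpow_increment) (use l comm in auto)
  then have "S l *v x = shift_monomial d S (\<alpha>(l := Suc (\<alpha> l))) *v p"
    by (simp add: p(1) matrix_vector_mul_assoc)
  then have "S l *v x \<in> span {shift_monomial d S \<alpha> *v \<phi> |\<alpha> \<phi>. \<phi> \<in> \<Phi>}"
    using p(2) by (auto intro: span_base)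
  then show ?case using step.IH
    by (simp add: matrix_vector_right_distrib matrix_vector_mult_scaleR span_add span_scale)
qed (simp add: span_zero)

lemma generator_in_shift_invariant_space:
  assumes "x \<in> \<Phi>"
  shows "x \<in> shift_invariant_space d S \<Phi>"
proof -
  have "foldr (**) (map (\<lambda>l. matpow (S l) 0) ls) (mat 1) = mat 1" for ls :: "nat list"
    by (induction ls) auto
  then have "x = shift_monomial d S (\<lambda>_. 0) *v x" by (simp add: shift_monomial_def)
  then show ?thesis unfolding shift_invariant_space_def using assms
    by (intro span_base) blast
qed

text \<open>Places the Krylov vectors in the shift-invariant space: a subspace invariant under each
  shift is invariant under their combinations and the powers of these.\<close>

lemma matpow_combination_in_shift_invariant_space:
  fixes S :: "nat \<Rightarrow> real^'v::finite^'v"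
  assumes "\<And>l l'. l \<in> {1..d} \<Longrightarrow> l' \<in> {1..d} \<Longrightarrow> S l ** S l' = S l' ** S l"
    and "x \<in> shift_invariant_space d S \<Phi>"
  shows "matpow (\<Sum>l=1..d. a l *\<^sub>R S l) k *v x \<in> shift_invariant_space d S \<Phi>"
proof (induction k)
  case (Suc k)
  let ?y = "matpow (\<Sum>l=1..d. a l *\<^sub>R S l) k *v x"
  have sub: "subspace (shift_invariant_space d S \<Phi>)" by (simp add: shift_invariant_space_def)
  have "(\<Sum>l=1..d. a l *\<^sub>R S l) *v ?y = (\<Sum>l=1..d. a l *\<^sub>R (S l *v ?y))"
    by (simp add: matrix_vector_mult_sum_left scaleR_matrix_vector_assoc)
  also have "\<dots> \<in> shift_invariant_space d S \<Phi>"
    using Suc assms(1) by (intro subspace_sum[OF sub] subspace_scale[OF sub] shift_invariant_space_invariant) auto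
  finally show ?case by (simp add: matrix_vector_mul_assoc)
qed (use assms in simp)

section \<open>Joint eigenspaces and the decomposition of signals\<close>

lemma joint_eigenspace_iff:
  "x \<in> joint_eigenspace d S g \<longleftrightarrow> (\<forall>l\<in>{1..d}. S l *v x = g l *\<^sub>R x)"
  by (simp add: joint_eigenspace_def matrix_vector_mult_diff_rdistrib
      scaleR_matrix_vector_assoc[symmetric])

lemma subspace_joint_eigenspace: "subspace (joint_eigenspace d S g)"
  by (auto simp: subspace_def joint_eigenspace_iff matrix_vector_right_distrib
      matrix_vector_mult_scaleR scaleR_add_right)

text \<open>Each factor acts on \<open>x\<close> as a scalar. Only the existence of \<open>c\<close>
  matters, as the lemma serves to keep monomials within the span of the components.\<close>

lemma shift_monomial_joint_eigenvector:
  assumes "x \<in> joint_eigenspace d S g"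
  shows "\<exists>c. shift_monomial d S \<alpha> *v x = c *\<^sub>R x"
proof -
  have *: "\<exists>c. foldr (**) (map (\<lambda>l. matpow (S l) (\<alpha> l)) ls) (mat 1) *v x = c *\<^sub>R x"
    if "set ls \<subseteq> {1..d}" for ls
    using that
  proof (induction ls)
    case Nil
    show ?case by (auto intro: exI[of _ 1])
  next
    case (Cons h t)
    then obtain c where c: "foldr (**) (map (\<lambda>l. matpow (S l) (\<alpha> l)) t) (mat 1) *v x = c *\<^sub>R x"
      by auto
    have "matpow (S h) (\<alpha> h) *v x = (g h ^ \<alpha> h) *\<^sub>R x"
      using Cons.prems assms by (intro matpow_eigenvector) (auto simp: joint_eigenspace_iff)
    then show ?case
      by (auto simp: matrix_vector_mul_assoc[symmetric] c matrix_vector_mult_scaleR)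
  qed
  show ?thesis unfolding shift_monomial_def by (rule *) auto
qed

lemma combination_joint_eigenvector:
  assumes "x \<in> joint_eigenspace d S g"
  shows "(\<Sum>l=1..d. a l *\<^sub>R S l) *v x = (\<Sum>l=1..d. a l * g l) *\<^sub>R x"
  using assms by (simp add: joint_eigenspace_iff matrix_vector_mult_sum_left
      scaleR_matrix_vector_assoc[symmetric] scaleR_sum_left)

lemma symmetric_matrix_eigenvectors_orthogonal:
  fixes A :: "real^'v::finite^'v"
  assumes "transpose A = A" "A *v x = a *\<^sub>R x" "A *v y = b *\<^sub>R y" "a \<noteq> b"
  shows "x \<bullet> y = 0"
proof -
  have "x v* A = A *v x" using transpose_matrix_vector[of A x] assms(1) by simp
  then have "a * (x \<bullet> y) = b * (x \<bullet> y)"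
    using dot_lmul_matrix[of x A y] assms(2,3) by simp
  with assms(4) show ?thesis by simp
qed

lemma transpose_combination:
  fixes S :: "'i \<Rightarrow> real^'v::finite^'v"
  assumes "\<And>l. l \<in> I \<Longrightarrow> transpose (S l) = S l"
  shows "transpose (\<Sum>l\<in>I. a l *\<^sub>R S l) = (\<Sum>l\<in>I. a l *\<^sub>R S l)"
proof -
  have "S l $ j $ i = S l $ i $ j" if "l \<in> I" for l i j
    using arg_cong[OF assms[OF that], of "\<lambda>A. A $ i $ j"] by (simp add: transpose_def)
  then show ?thesis by (simp add: vec_eq_iff transpose_def)
qed

lemma outer_mult_vec: "outer u *v x = (u \<bullet> x) *\<^sub>R u"
  by (simp add: vec_eq_iff outer_def matrix_vector_mult_def inner_vec_def sum_distrib_right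
      sum_distrib_left mult_ac)

text \<open>This is \<open>U ** transpose U = mat 1\<close> applied to \<open>x\<close>: the entries
  of \<open>transpose U *v x\<close> are the coefficients of the columns.\<close>

lemma orthogonal_matrix_column_expansion:
  fixes U :: "real^'v::finite^'v"
  assumes "orthogonal_matrix U"
  shows "x = (\<Sum>n\<in>UNIV. (column n U \<bullet> x) *\<^sub>R column n U)"
proof -
  have "x = U *v (transpose U *v x)"
    using assms by (simp add: orthogonal_matrix_def matrix_vector_mul_assoc del: transpose_matrix_vector)
  also have "\<dots> = (\<Sum>n\<in>UNIV. (column n U \<bullet> x) *\<^sub>R column n U)"
    by (simp add: matrix_mult_sum scalar_mult_eq_scaleR matrix_vector_mult_def transpose_def
        column_def inner_vec_def mult.commute del: transpose_matrix_vector)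
  finally show ?thesis .
qed

text \<open>By orthonormality only the rank-one term with index \<open>n\<close> survives on
  \<open>column n U\<close>.\<close>

lemma column_in_joint_eigenspace:
  assumes "joint_eigendecomposition d S U lam"
  shows "column n U \<in> joint_eigenspace d S (restrict (\<lambda>l. lam l n) {1..d})"
  unfolding joint_eigenspace_iff
proof
  fix l assume l: "l \<in> {1..d}"
  have on: "column k U \<bullet> column n U = (if k = n then 1 else 0)" for k
    using assms unfolding joint_eigendecomposition_def orthogonal_matrix_orthonormal_columns
    by (auto simp: orthogonal_def norm_eq_1)
  have "S l *v column n U = (\<Sum>k\<in>UNIV. lam l k *\<^sub>R outer (column k U)) *v column n U"
    using assms l by (simp add: joint_eigendecomposition_def)
  also have "\<dots> = (\<Sum>k\<in>UNIV. if k = n then lam l n *\<^sub>R column n U else 0)"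
    unfolding matrix_vector_mult_sum_left
    by (rule sum.cong) (auto simp: scaleR_matrix_vector_assoc[symmetric] outer_mult_vec on)
  finally show "S l *v column n U = restrict (\<lambda>l. lam l n) {1..d} l *\<^sub>R column n U"
    using l by simp
qed

text \<open>The expansion in the columns of \<open>U\<close> is grouped by joint eigenvalue: columns
  with the same label \<open>g\<close> add up to \<open>w g\<close>, a vector of the eigenspace of
  \<open>g\<close>. The bijection \<open>\<gamma>\<close> then turns labels into indices.\<close>

lemma joint_eigenspace_decomposition:
  assumes dec: "joint_eigendecomposition d S U lam"
    and bij: "bij_betw \<gamma> I (joint_spectrum d lam)"
  shows "\<exists>v. (\<forall>m\<in>I. v m \<in> joint_eigenspace d S (\<gamma> m)) \<and> x = (\<Sum>m\<in>I. v m)"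
proof -
  define L where "L n = restrict (\<lambda>l. lam l n) {1..d}" for n
  define w where "w g = (\<Sum>n | n \<in> UNIV \<and> L n = g. (column n U \<bullet> x) *\<^sub>R column n U)" for g
  have w: "w g \<in> joint_eigenspace d S g" for g
    unfolding w_def using column_in_joint_eigenspace[OF dec, folded L_def]
    by (intro subspace_sum subspace_scale subspace_joint_eigenspace) auto
  have "x = (\<Sum>n\<in>UNIV. (column n U \<bullet> x) *\<^sub>R column n U)"
    using dec by (intro orthogonal_matrix_column_expansion) (simp add: joint_eigendecomposition_def)
  also have "\<dots> = (\<Sum>g\<in>range L. w g)"
    unfolding w_def by (rule sum.image_gen) simp
  also have "range L = joint_spectrum d lam"
    by (simp add: joint_spectrum_def L_def)
  also have "(\<Sum>g\<in>joint_spectrum d lam. w g) = (\<Sum>m\<in>I. w (\<gamma> m))"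
    by (rule sum.reindex_bij_betw[OF bij, symmetric])
  finally show ?thesis using w by (intro exI[of _ "\<lambda>m. w (\<gamma> m)"]) simp
qed

section \<open>The dimension count and the characterization\<close>

lemma sum_eq_card_mult_iff:
  fixes f :: "'i \<Rightarrow> nat"
  assumes "finite I" "\<And>i. i \<in> I \<Longrightarrow> f i \<le> r"
  shows "(\<Sum>i\<in>I. f i) = card I * r \<longleftrightarrow> (\<forall>i\<in>I. f i = r)"
  using sum_mono_inv[of f I "\<lambda>_. r"] assms by auto

theorem theorem4p16:
  fixes E :: "'v::finite rel"
    and S :: "nat \<Rightarrow> real^'v^'v" and d :: nat
    and U :: "real^'v^'v" and lam :: "nat \<Rightarrow> 'v \<Rightarrow> real"
    and \<gamma> :: "nat \<Rightarrow> nat \<Rightarrow> real" and M :: nat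
    and \<phi> :: "nat \<Rightarrow> real^'v" and r :: nat
    and a :: "nat \<Rightarrow> real" and T :: "real^'v^'v"
  assumes "CARD('v) \<ge> 2"
    and "simple_undirected_graph E"
    and "d \<ge> 1"
    and "\<And>l. l \<in> {1..d} \<Longrightarrow> graph_shift E (S l)"
    and "\<And>l. l \<in> {1..d} \<Longrightarrow> transpose (S l) = S l"
    and "\<And>l l'. l \<in> {1..d} \<Longrightarrow> l' \<in> {1..d} \<Longrightarrow> S l ** S l' = S l' ** S l"
    and "joint_eigendecomposition d S U lam"
    and "bij_betw \<gamma> {1..M} (joint_spectrum d lam)"
    and "r \<ge> 1"
    and "\<And>i. i \<in> {1..r} \<Longrightarrow> \<phi> i \<noteq> 0"
    and "inj_on (\<lambda>m. \<Sum>l=1..d. a l * \<gamma> m l) {1..M}"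
    and "T = (\<Sum>l=1..d. a l *\<^sub>R S l)"
  shows "riesz_basis ({0..M-1} \<times> {1..r}) (\<lambda>(k, i). matpow T k *v \<phi> i)
           (shift_invariant_space d S (\<phi> ` {1..r}))
    \<longleftrightarrow> (\<forall>m\<in>{1..M}. spectral_dim d S (shift_invariant_space d S (\<phi> ` {1..r})) (\<gamma> m) = r)"
proof -
  let ?I = "{1..M}" and ?J = "{1..r}"
  let ?H = "shift_invariant_space d S (\<phi> ` ?J)"
  let ?W = "\<lambda>m. joint_eigenspace d S (\<gamma> m)"
  let ?\<mu> = "\<lambda>m. \<Sum>l=1..d. a l * \<gamma> m l"
  note comm = assms(6) and T = assms(12)
  have "\<forall>i. \<exists>v. (\<forall>m\<in>?I. v m \<in> ?W m) \<and> \<phi> i = (\<Sum>m\<in>?I. v m)"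
    using joint_eigenspace_decomposition[OF assms(7,8)] by blast
  then obtain v where vW: "\<And>i m. m \<in> ?I \<Longrightarrow> v i m \<in> ?W m"
    and v: "\<And>i. \<phi> i = (\<Sum>m\<in>?I. v i m)"
    unfolding choice_iff by blast
  \<comment> \<open>The components of all generators at the joint eigenvalue
    \<open>\<gamma> m\<close>: at most \<open>r\<close> distinct vectors.\<close>
  define A where "A m = (\<lambda>i. v i m) ` ?J" for m
  have eig: "T *v x = ?\<mu> m *\<^sub>R x" if "x \<in> ?W m" for x m
    unfolding T using that by (rule combination_joint_eigenvector)
  \<comment> \<open>The single symmetric matrix \<open>T\<close> separates the joint eigenspaces,
    because its eigenvalues \<open>?\<mu> m\<close> are distinct.\<close>
  have orth: "x \<bullet> y = 0" if "m \<in> ?I" "m' \<in> ?I" "m \<noteq> m'" "x \<in> ?W m" "y \<in> ?W m'" for m m' x y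
  proof (rule symmetric_matrix_eigenvectors_orthogonal[OF _ eig eig])
    show "transpose T = T" unfolding T by (rule transpose_combination) (rule assms(5))
    show "?\<mu> m \<noteq> ?\<mu> m'" using inj_onD[OF assms(11)] that by blast
  qed (use that in auto)
  have AW: "A m \<subseteq> ?W m" if "m \<in> ?I" for m using vW[OF that] by (auto simp: A_def)
  have krylov: "span ((\<lambda>(k, i). matpow T k *v \<phi> i) ` ({0..M-1} \<times> ?J)) = span (\<Union>m\<in>?I. A m)"
    using span_krylov_eq_span_eigencomponents[OF _ assms(11), of ?J T v \<phi>] eig vW v
    by (simp add: A_def)
  \<comment> \<open>\<open>?H\<close> is invariant under \<open>T\<close> and so contains the Krylov
    vectors; conversely, monomials only rescale the components \<open>v i m\<close>. With
    \<open>krylov\<close>, the spanning half of the Riesz property always holds.\<close>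
  have H: "?H = span (\<Union>m\<in>?I. A m)"
  proof
    show "span (\<Union>m\<in>?I. A m) \<subseteq> ?H"
      unfolding krylov[symmetric]
    proof (rule span_minimal)
      have "matpow T k *v \<phi> i \<in> ?H" if "i \<in> ?J" for k i
        unfolding T using comm generator_in_shift_invariant_space[of "\<phi> i" "\<phi> ` ?J"] that
        by (intro matpow_combination_in_shift_invariant_space) blast+
      then show "(\<lambda>(k, i). matpow T k *v \<phi> i) ` ({0..M-1} \<times> ?J) \<subseteq> ?H"
        by (auto simp del: One_nat_def)
    qed (simp add: shift_invariant_space_def)
    show "?H \<subseteq> span (\<Union>m\<in>?I. A m)"
      unfolding shift_invariant_space_def
    proof (rule span_minimal, safe)
      fix \<alpha> i assume i: "i \<in> ?J"
      have "shift_monomial d S \<alpha> *v v i m \<in> span (\<Union>m\<in>?I. A m)" if m: "m \<in> ?I" for m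
      proof -
        have "v i m \<in> span (\<Union>m\<in>?I. A m)" unfolding A_def
          by (intro span_base UN_I[OF m] imageI i)
        then show ?thesis
          using shift_monomial_joint_eigenvector[OF vW[OF m], of \<alpha> i] by (auto intro: span_scale)
      qed
      then show "shift_monomial d S \<alpha> *v \<phi> i \<in> span (\<Union>m\<in>?I. A m)"
        unfolding v[of i] matrix_vector_mult_sum_right by (rule span_sum)
    qed
  qed
  have sd: "spectral_dim d S ?H (\<gamma> m) = dim (A m)" if "m \<in> ?I" for m
  proof -
    have "span (\<Union>j\<in>?I. A j) \<inter> ?W m = span (A m)"
      by (rule span_UN_Int_orthogonal[OF subspace_joint_eigenspace AW orth that])
    then show ?thesis unfolding spectral_dim_def H by simp
  qed
  have le: "dim (A m) \<le> r" for m
  proof -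
    have "dim (A m) \<le> card (A m)" by (rule dim_le_card') (simp add: A_def)
    also have "\<dots> \<le> r" unfolding A_def using card_image_le[of ?J "\<lambda>i. v i m"] by simp
    finally show ?thesis .
  qed
  have dimH: "dim ?H = (\<Sum>m\<in>?I. dim (A m))"
    unfolding H dim_span by (rule dim_UN_orthogonal) (use AW orth in blast)+
  \<comment> \<open>The spectrum is nonempty, so \<open>M\<close> is positive. For
    \<open>M = 0\<close> the truncated \<open>M-1\<close> would leave one power in
    \<open>{0..M-1}\<close>, and the family would not have \<open>M * r\<close> members.\<close>
  have "\<gamma> ` ?I = joint_spectrum d lam" using assms(8) by (rule bij_betw_imp_surj_on)
  then have "?I \<noteq> {}" unfolding joint_spectrum_def by blast
  then have "card ({0..M-1} \<times> ?J) = M * r" by (cases M) auto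
  then have "riesz_basis ({0..M-1} \<times> ?J) (\<lambda>(k, i). matpow T k *v \<phi> i) ?H \<longleftrightarrow> dim ?H = M * r"
    by (simp add: riesz_basis_iff_dim krylov H del: One_nat_def)
  \<comment> \<open>\<open>M\<close> dimensions, each at most \<open>r\<close>, reach the total
    \<open>M * r\<close> only if all are equal to \<open>r\<close>.\<close>
  also have "\<dots> \<longleftrightarrow> (\<forall>m\<in>?I. dim (A m) = r)"
    using sum_eq_card_mult_iff[of ?I "\<lambda>m. dim (A m)" r] le unfolding dimH by simp
  finally show ?thesis using sd by (simp del: One_nat_def)
qed

end
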